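(* Let $s\ge 1$, let $w=(w_1,\ldots,w_s)\in\mathbb{N}^s$, and let $f\in\mathbb{C}[x_1,\ldots,x_s]$ be a weighted homogeneous polynomial of weight $w$ and degree $d$. Then for every integer $n\ge 1$ the ideal $\mathcal{J}_n(f)\subset\mathbb{C}[x_1,\ldots,x_s]$, generated by all maximal minors of the Jacobian matrix of order $n$ of $f$, is a weighted homogeneous ideal (with respect to $w$).
   Context: $\mathbb{N}$ includes $0$. For $\gamma\in\mathbb{N}^s$, $|\gamma|=\gamma_1+\cdots+\gamma_s$, $\gamma!=\gamma_1!\cdots\gamma_s!$, and $\gamma\cdot w=\sum_i\gamma_iw_i$. A polynomial is weighted homogeneous of weight $w$ and degree $d$ if every monomial $x^\gamma$ occurring in it with nonzero coefficient satisfies $\gamma\cdot w=d$. An ideal is weighted homogeneous (with respect to $w$) if it is generated by polynomials that are weighted homogeneous of weight $w$ (of possibly different degrees). Let $B=\{\beta\in\mathbb{N}^s : 0\le|\beta|\le n-1\}$ and $A_1=\{\alpha\in\mathbb{N}^s : 1\le|\alpha|\le n\}$, and let $M=\mathrm{Card}(B)=\binom{s+n-1}{s}$, $N=\binom{s+n}{s}$, so $\mathrm{Card}(A_1)=N-1$. The Jacobian matrix of order $n$ of $f$ is the $M\times(N-1)$ matrix $$\mathrm{Jac}_n(f)=\left(\frac{1}{(\alpha-\beta)!}\frac{\partial^{\alpha-\beta}(f)}{\partial x^{\alpha-\beta}}\right)_{\beta\in B,\ \alpha\in A_1},$$ with rows indexed by $B$ and columns by $A_1$ (each ordered increasingly by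 a graded lexicographical order with $x_1<\cdots<x_s$), where the entry is defined to be $0$ whenever $\alpha_i<\beta_i$ for some $i$ (and the entry is $f$ when $\alpha=\beta$). Its maximal minors are the determinants of its $M\times M$ submatrices, and $\mathcal{J}_n(f)$ is the ideal they generate. *)

theory Defs
  imports
    Complex_Main
    "HOL-Library.Poly_Mapping"
    "Jordan_Normal_Form.Determinant"
    "Jordan_Normal_Form.DL_Submatrix"
begin

text \<open>
  The variables $x_1 < \dots < x_s$ are the elements of a finite linear order \<open>'s\<close>, so that
  \<open>s = CARD('s)\<close>.  Multi-indices are finitely supported functions \<open>'s \<Rightarrow>\<^sub>0 nat\<close>; polynomials are
  finitely supported functions from multi-indices to coefficients, with the convolution product.
\<close>

type_synonym 's mindex = "'s \<Rightarrow>\<^sub>0 nat"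
type_synonym 's cpoly = "'s mindex \<Rightarrow>\<^sub>0 complex"


subsection \<open>Multi-indices\<close>

definition mdeg :: "'s::finite mindex \<Rightarrow> nat" where
  "mdeg \<gamma> = (\<Sum>i\<in>UNIV. Poly_Mapping.lookup \<gamma> i)"

definition mfact :: "'s::finite mindex \<Rightarrow> nat" where
  "mfact \<gamma> = (\<Prod>i\<in>UNIV. fact (Poly_Mapping.lookup \<gamma> i))"

definition wdeg :: "('s::finite \<Rightarrow> nat) \<Rightarrow> 's mindex \<Rightarrow> nat" where
  "wdeg w \<gamma> = (\<Sum>i\<in>UNIV. Poly_Mapping.lookup \<gamma> i * w i)"

definition mle :: "'s mindex \<Rightarrow> 's mindex \<Rightarrow> bool" where
  "mle \<beta> \<alpha> \<longleftrightarrow> (\<forall>i. Poly_Mapping.lookup \<beta> i \<le> Poly_Mapping.lookup \<alpha> i)"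

text \<open>
  Graded lexicographical order.  Ties in the degree are broken at the largest variable in which
  the exponents differ, which gives $x_1 < \dots < x_s$.  The \<open>linorder\<close> instance that the library
  provides for \<open>'s \<Rightarrow>\<^sub>0 nat\<close> is ungraded and makes the smallest variable most significant.
\<close>

definition grlex_less :: "'s::{finite,linorder} mindex \<Rightarrow> 's mindex \<Rightarrow> bool" where
  "grlex_less \<alpha> \<beta> \<longleftrightarrow> mdeg \<alpha> < mdeg \<beta> \<or>
     mdeg \<alpha> = mdeg \<beta> \<and>
     (\<exists>i. Poly_Mapping.lookup \<alpha> i < Poly_Mapping.lookup \<beta> i \<and> (\<forall>j>i. Poly_Mapping.lookup \<alpha> j = Poly_Mapping.lookup \<beta> j))"

definition grlex_le :: "'s::{finite,linorder} mindex \<Rightarrow> 's mindex \<Rightarrow> bool" where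
  "grlex_le \<alpha> \<beta> \<longleftrightarrow> \<alpha> = \<beta> \<or> grlex_less \<alpha> \<beta>"

lemma grlex_less_trans:
  fixes \<alpha> \<beta> \<gamma> :: "'s::{finite,linorder} mindex"
  assumes "grlex_less \<alpha> \<beta>" "grlex_less \<beta> \<gamma>"
  shows "grlex_less \<alpha> \<gamma>"
proof (cases "mdeg \<alpha> < mdeg \<beta> \<or> mdeg \<beta> < mdeg \<gamma>")
  case True
  with assms show ?thesis by (auto simp: grlex_less_def)
next
  case False
  with assms obtain i k where
    deg: "mdeg \<alpha> = mdeg \<gamma>" and
    i: "Poly_Mapping.lookup \<alpha> i < Poly_Mapping.lookup \<beta> i" "\<forall>j>i. Poly_Mapping.lookup \<alpha> j = Poly_Mapping.lookup \<beta> j" and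
    k: "Poly_Mapping.lookup \<beta> k < Poly_Mapping.lookup \<gamma> k" "\<forall>j>k. Poly_Mapping.lookup \<beta> j = Poly_Mapping.lookup \<gamma> j"
    by (auto simp: grlex_less_def)
  have "Poly_Mapping.lookup \<alpha> (max i k) < Poly_Mapping.lookup \<gamma> (max i k)"
  proof (cases i k rule: linorder_cases)
    case less
    then show ?thesis using i(2) k(1) by (simp add: max_absorb2)
  next
    case equal
    then show ?thesis using i(1) k(1) by simp
  next
    case greater
    then show ?thesis using i(1) k(2) by (simp add: max_absorb1)
  qed
  moreover have "\<forall>j>max i k. Poly_Mapping.lookup \<alpha> j = Poly_Mapping.lookup \<gamma> j"
    using i(2) k(2) by simp
  ultimately show ?thesis
    using deg unfolding grlex_less_def by blast
qed

lemma grlex_less_irrefl: "\<not> grlex_less \<alpha> \<alpha>"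
  by (simp add: grlex_less_def)

lemma grlex_less_linear:
  fixes \<alpha> \<beta> :: "'s::{finite,linorder} mindex"
  shows "\<alpha> = \<beta> \<or> grlex_less \<alpha> \<beta> \<or> grlex_less \<beta> \<alpha>"
proof (cases "\<alpha> = \<beta>")
  case False
  define D where "D = {i. Poly_Mapping.lookup \<alpha> i \<noteq> Poly_Mapping.lookup \<beta> i}"
  have "D \<noteq> {}"
    using False by (auto simp: D_def intro: poly_mapping_eqI)
  then have "Max D \<in> D"
    by (intro Max_in) auto
  moreover have "Poly_Mapping.lookup \<alpha> j = Poly_Mapping.lookup \<beta> j" if "j > Max D" for j
  proof (rule ccontr)
    assume "Poly_Mapping.lookup \<alpha> j \<noteq> Poly_Mapping.lookup \<beta> j"
    then have "j \<le> Max D" by (intro Max_ge) (auto simp: D_def)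
    with that show False by simp
  qed
  ultimately show ?thesis
    unfolding grlex_less_def D_def
    by (metis (mono_tags, lifting) linorder_neqE_nat mem_Collect_eq)
qed simp

interpretation grlex: linorder grlex_le grlex_less
proof
  fix \<alpha> \<beta> \<gamma> :: "'s::{finite,linorder} mindex"
  show "grlex_less \<alpha> \<beta> \<longleftrightarrow> grlex_le \<alpha> \<beta> \<and> \<not> grlex_le \<beta> \<alpha>"
    unfolding grlex_le_def by (metis grlex_less_irrefl grlex_less_trans)
  show "grlex_le \<alpha> \<alpha>"
    by (simp add: grlex_le_def)
  show "grlex_le \<alpha> \<beta> \<Longrightarrow> grlex_le \<beta> \<gamma> \<Longrightarrow> grlex_le \<alpha> \<gamma>"
    unfolding grlex_le_def by (metis grlex_less_trans)
  show "grlex_le \<alpha> \<beta> \<Longrightarrow> grlex_le \<beta> \<alpha> \<Longrightarrow> \<alpha> = \<beta>"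
    unfolding grlex_le_def by (metis grlex_less_irrefl grlex_less_trans)
  show "grlex_le \<alpha> \<beta> \<or> grlex_le \<beta> \<alpha>"
    unfolding grlex_le_def using grlex_less_linear by metis
qed


subsection \<open>Partial derivatives\<close>

text \<open>
  If \<open>Poly_Mapping.lookup \<gamma> i = 0\<close> then the subtraction truncates, but the coefficient is \<open>0\<close>.
\<close>

definition pdiff :: "'s \<Rightarrow> 's cpoly \<Rightarrow> 's cpoly" where
  "pdiff i f = (\<Sum>\<gamma>\<in>Poly_Mapping.keys f.
     Poly_Mapping.single (\<gamma> - Poly_Mapping.single i 1) (of_nat (Poly_Mapping.lookup \<gamma> i) * Poly_Mapping.lookup f \<gamma>))"

lemma lookup_pdiff:
  "Poly_Mapping.lookup (pdiff i f) \<gamma> =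
     of_nat (Poly_Mapping.lookup \<gamma> i + 1) * Poly_Mapping.lookup f (\<gamma> + Poly_Mapping.single i 1)"
proof -
  let ?e = "Poly_Mapping.single i (1::nat)"
  have eq: "(of_nat (Poly_Mapping.lookup \<delta> i) * Poly_Mapping.lookup f \<delta> when \<delta> - ?e = \<gamma>) =
    (if \<delta> = \<gamma> + ?e then of_nat (Poly_Mapping.lookup \<delta> i) * Poly_Mapping.lookup f \<delta> else 0)" for \<delta>
  proof (cases "Poly_Mapping.lookup \<delta> i = 0")
    case False
    then have "\<delta> - ?e + ?e = \<delta>"
      by (intro poly_mapping_eqI) (auto simp: lookup_add lookup_minus lookup_single when_def)
    then have "\<delta> - ?e = \<gamma> \<longleftrightarrow> \<delta> = \<gamma> + ?e" by auto
    then show ?thesis by (simp add: when_def)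
  qed (auto simp: when_def)
  show ?thesis
    unfolding pdiff_def lookup_sum lookup_single eq
    by (auto simp: sum.delta lookup_add in_keys_iff)
qed

definition mdiff :: "'s::{finite,linorder} mindex \<Rightarrow> 's cpoly \<Rightarrow> 's cpoly" where
  "mdiff \<gamma> f = foldr (\<lambda>i. pdiff i ^^ Poly_Mapping.lookup \<gamma> i) (sorted_list_of_set UNIV) f"


subsection \<open>Weighted homogeneity\<close>

definition weighted_homogeneous :: "('s::finite \<Rightarrow> nat) \<Rightarrow> nat \<Rightarrow> 's cpoly \<Rightarrow> bool" where
  "weighted_homogeneous w d f \<longleftrightarrow> (\<forall>\<gamma>. Poly_Mapping.lookup f \<gamma> \<noteq> 0 \<longrightarrow> wdeg w \<gamma> = d)"

text \<open>
  The ideal generated by a subset of a commutative ring is its span in the ring as a module over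
  itself.
\<close>

interpretation ideal: Modules.module "(*) :: 'a::comm_ring_1 \<Rightarrow> 'a \<Rightarrow> 'a"
  by standard (simp_all add: algebra_simps)

definition weighted_homogeneous_ideal :: "('s::finite \<Rightarrow> nat) \<Rightarrow> 's cpoly set \<Rightarrow> bool" where
  "weighted_homogeneous_ideal w I \<longleftrightarrow>
     (\<exists>G. (\<forall>g\<in>G. \<exists>d. weighted_homogeneous w d g) \<and> I = ideal.span G)"


subsection \<open>The Jacobian matrix of order \<open>n\<close>\<close>

lemma finite_mdeg_le: "finite {\<gamma> :: 's::finite mindex. mdeg \<gamma> \<le> n}"
proof (rule finite_imageD)
  have "Poly_Mapping.lookup \<gamma> i \<le> mdeg \<gamma>" for \<gamma> :: "'s mindex" and i
    unfolding mdeg_def by (rule member_le_sum) auto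
  then have "Poly_Mapping.lookup ` {\<gamma> :: 's mindex. mdeg \<gamma> \<le> n} \<subseteq> PiE UNIV (\<lambda>_. {..n})"
    by (auto simp: PiE_def intro: order_trans)
  then show "finite (Poly_Mapping.lookup ` {\<gamma> :: 's mindex. mdeg \<gamma> \<le> n})"
    by (rule finite_subset) (intro finite_PiE, auto)
  show "inj_on Poly_Mapping.lookup {\<gamma> :: 's mindex. mdeg \<gamma> \<le> n}"
    by (auto intro: inj_onI poly_mapping_eqI)
qed

definition jac_rows :: "nat \<Rightarrow> 's::{finite,linorder} mindex list" where
  "jac_rows n = grlex.sorted_list_of_set {\<beta>. mdeg \<beta> \<le> n - 1}"

definition jac_cols :: "nat \<Rightarrow> 's::{finite,linorder} mindex list" where
  "jac_cols n = grlex.sorted_list_of_set {\<alpha>. 1 \<le> mdeg \<alpha> \<and> mdeg \<alpha> \<le> n}"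

lemma set_jac_rows: "set (jac_rows n) = {\<beta>. mdeg \<beta> \<le> n - 1}"
  by (simp add: jac_rows_def finite_mdeg_le)

lemma length_jac_rows:
  "length (jac_rows n :: 's::{finite,linorder} mindex list) = card {\<beta> :: 's mindex. mdeg \<beta> \<le> n - 1}"
  by (simp add: jac_rows_def finite_mdeg_le)

lemma set_jac_cols: "set (jac_cols n) = {\<alpha>. 1 \<le> mdeg \<alpha> \<and> mdeg \<alpha> \<le> n}"
  by (simp add: jac_cols_def finite_subset[OF _ finite_mdeg_le[of n]] subset_iff)

lemma length_jac_cols:
  "length (jac_cols n :: 's::{finite,linorder} mindex list) =
     card {\<alpha> :: 's mindex. 1 \<le> mdeg \<alpha> \<and> mdeg \<alpha> \<le> n}"
  by (simp add: jac_cols_def finite_subset[OF _ finite_mdeg_le[of n]] subset_iff)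

definition jac_entry ::
  "'s::{finite,linorder} cpoly \<Rightarrow> 's mindex \<Rightarrow> 's mindex \<Rightarrow> 's cpoly" where
  "jac_entry f \<beta> \<alpha> =
     (if mle \<beta> \<alpha>
      then Poly_Mapping.single 0 (1 / of_nat (mfact (\<alpha> - \<beta>))) * mdiff (\<alpha> - \<beta>) f
      else 0)"

definition Jac :: "nat \<Rightarrow> 's::{finite,linorder} cpoly \<Rightarrow> 's cpoly mat" where
  "Jac n f = mat (length (jac_rows n :: 's mindex list)) (length (jac_cols n :: 's mindex list))
     (\<lambda>(i, j). jac_entry f (jac_rows n ! i) (jac_cols n ! j))"

text \<open>
  For a matrix with at least as many columns as rows: all rows and equally many columns are
  selected.
\<close>

definition maximal_minors :: "'a::comm_ring_1 mat \<Rightarrow> 'a set" where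
  "maximal_minors A =
     {det (submatrix A {..<dim_row A} J) | J. J \<subseteq> {..<dim_col A} \<and> card J = dim_row A}"

definition jacobian_ideal :: "nat \<Rightarrow> 's::{finite,linorder} cpoly \<Rightarrow> 's cpoly set" where
  "jacobian_ideal n f = ideal.span (maximal_minors (Jac n f))"

end

(* Grade by integers, so that degrees may be negative: if f is homogeneous of degree d, the
   (\<beta>, \<alpha>) entry of the Jacobian matrix is homogeneous of degree (\<beta> . w) + (d - \<alpha> . w).
   When the degree of the entries of a square matrix splits in this way into a row part and a
   column part, all terms of the Leibniz expansion have the same degree, so the determinant is
   homogeneous.  The maximal minors themselves are thus homogeneous generators. *)
theory Submission
  imports Defs
begin

definition int_homogeneous :: "('s::finite \<Rightarrow> nat) \<Rightarrow> int \<Rightarrow> 's cpoly \<Rightarrow> bool" where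
  "int_homogeneous w k p \<longleftrightarrow> (\<forall>\<gamma>. Poly_Mapping.lookup p \<gamma> \<noteq> 0 \<longrightarrow> int (wdeg w \<gamma>) = k)"

lemma int_homogeneousD:
  "int_homogeneous w k p \<Longrightarrow> Poly_Mapping.lookup p \<gamma> \<noteq> 0 \<Longrightarrow> int (wdeg w \<gamma>) = k"
  by (simp add: int_homogeneous_def)

lemma int_homogeneous_of_nat:
  "int_homogeneous w (int d) p \<longleftrightarrow> weighted_homogeneous w d p"
  by (simp add: int_homogeneous_def weighted_homogeneous_def)

text \<open>A negative \<open>k\<close> forces \<open>p = 0\<close>, which is homogeneous of every
  degree, so the truncation by \<open>nat\<close> does no harm.\<close>

lemma int_homogeneous_imp_weighted_homogeneous:
  "int_homogeneous w k p \<Longrightarrow> weighted_homogeneous w (nat k) p"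
  by (auto simp: int_homogeneous_def weighted_homogeneous_def)

lemma wdeg_add: "wdeg w (\<gamma> + \<delta>) = wdeg w \<gamma> + wdeg w \<delta>"
  by (simp add: wdeg_def lookup_add algebra_simps sum.distrib)

lemma wdeg_single: "wdeg w (Poly_Mapping.single i m) = m * w i"
proof -
  have "wdeg w (Poly_Mapping.single i m) = (\<Sum>j\<in>UNIV. if i = j then m * w j else 0)"
    unfolding wdeg_def by (intro sum.cong) (auto simp: lookup_single)
  then show ?thesis by simp
qed

lemma wdeg_zero [simp]: "wdeg w 0 = 0"
  by (simp add: wdeg_def)

lemma wdeg_diff:
  assumes "mle \<beta> \<alpha>"
  shows "int (wdeg w (\<alpha> - \<beta>)) = int (wdeg w \<alpha>) - int (wdeg w \<beta>)"
proof -
  \<comment> \<open>Subtraction of multi-indices truncates pointwise; \<open>mle\<close> makes it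
    exact.\<close>
  have "(\<alpha> - \<beta>) + \<beta> = \<alpha>"
    using assms by (intro poly_mapping_eqI) (simp add: mle_def lookup_add lookup_minus)
  then show ?thesis
    using wdeg_add[of w "\<alpha> - \<beta>" \<beta>] by simp
qed

lemma int_homogeneous_zero [simp]: "int_homogeneous w k 0"
  by (simp add: int_homogeneous_def)

lemma int_homogeneous_single_zero: "int_homogeneous w 0 (Poly_Mapping.single 0 c)"
  by (simp add: int_homogeneous_def lookup_single when_def)

lemma int_homogeneous_add:
  assumes "int_homogeneous w k p" "int_homogeneous w k q"
  shows "int_homogeneous w k (p + q)"
  unfolding int_homogeneous_def lookup_add
  using assms by (metis add.left_neutral int_homogeneousD)

lemma int_homogeneous_uminus:
  "int_homogeneous w k p \<Longrightarrow> int_homogeneous w k (- p)"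
  by (simp add: int_homogeneous_def)

lemma int_homogeneous_sum:
  "(\<And>x. x \<in> A \<Longrightarrow> int_homogeneous w k (p x)) \<Longrightarrow> int_homogeneous w k (sum p A)"
  by (induction A rule: infinite_finite_induct) (auto intro: int_homogeneous_add)

lemma int_homogeneous_mult:
  assumes "int_homogeneous w k p" "int_homogeneous w l q"
  shows "int_homogeneous w (k + l) (p * q)"
  unfolding int_homogeneous_def
proof (intro allI impI)
  fix \<gamma> assume "Poly_Mapping.lookup (p * q) \<gamma> \<noteq> 0"
  then have "\<gamma> \<in> Poly_Mapping.keys (p * q)" by (simp add: in_keys_iff)
  then obtain a b where "\<gamma> = a + b" "a \<in> Poly_Mapping.keys p" "b \<in> Poly_Mapping.keys q"
    using keys_mult[of p q] by blast
  then show "int (wdeg w \<gamma>) = k + l"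
    using assms by (simp add: wdeg_add in_keys_iff int_homogeneousD)
qed

lemma int_homogeneous_prod:
  assumes "\<And>x. x \<in> A \<Longrightarrow> int_homogeneous w (k x) (p x)"
  shows "int_homogeneous w (sum k A) (prod p A)"
  using assms
proof (induction A rule: infinite_finite_induct)
  case (insert x A)
  then show ?case by (auto intro: int_homogeneous_mult)
\<comment> \<open>For an empty or infinite index set the product is 1 and the sum of degrees is 0;
  \<open>single_one\<close> exhibits 1 as a constant.\<close>
qed (auto simp flip: single_one intro: int_homogeneous_single_zero)

text \<open>The coefficient at \<gamma> comes from the monomial of \<open>p\<close> whose exponent
  of variable \<open>i\<close> is one larger, hence whose weight is larger by \<open>w i\<close>. If
  \<open>k < w i\<close>, the derivative vanishes.\<close>

lemma int_homogeneous_pdiff: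
  assumes "int_homogeneous w k p"
  shows "int_homogeneous w (k - int (w i)) (pdiff i p)"
  unfolding int_homogeneous_def lookup_pdiff
proof (intro allI impI)
  fix \<gamma>
  assume "of_nat (Poly_Mapping.lookup \<gamma> i + 1) *
    Poly_Mapping.lookup p (\<gamma> + Poly_Mapping.single i 1) \<noteq> 0"
  then have "int (wdeg w (\<gamma> + Poly_Mapping.single i 1)) = k"
    using assms by (intro int_homogeneousD) auto
  then show "int (wdeg w \<gamma>) = k - int (w i)"
    by (simp add: wdeg_add wdeg_single)
qed

lemma int_homogeneous_pdiff_funpow:
  assumes "int_homogeneous w k p"
  shows "int_homogeneous w (k - int (m * w i)) ((pdiff i ^^ m) p)"
proof (induction m)
  case (Suc m)
  from int_homogeneous_pdiff[OF this, of i] show ?case by (simp add: algebra_simps)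
qed (use assms in simp)

lemma int_homogeneous_mdiff:
  fixes w :: "'s::{finite,linorder} \<Rightarrow> nat"
  assumes "int_homogeneous w k p"
  shows "int_homogeneous w (k - int (wdeg w \<gamma>)) (mdiff \<gamma> p)"
proof -
  \<comment> \<open>Generalised to any list of variables for the induction; the list of all
    variables, being distinct, turns the sum into \<open>wdeg w \<gamma>\<close>.\<close>
  have "int_homogeneous w (k - (\<Sum>i\<leftarrow>xs. int (Poly_Mapping.lookup \<gamma> i * w i)))
      (foldr (\<lambda>i. pdiff i ^^ Poly_Mapping.lookup \<gamma> i) xs p)" for xs
  proof (induction xs)
    case (Cons i xs)
    from int_homogeneous_pdiff_funpow[OF this, of "Poly_Mapping.lookup \<gamma> i" i]
    show ?case by (simp add: algebra_simps)
  qed (use assms in simp)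
  from this[of "sorted_list_of_set UNIV"] show ?thesis
    by (simp add: mdiff_def wdeg_def sum_list_distinct_conv_sum_set)
qed

lemma int_homogeneous_jac_entry:
  assumes "int_homogeneous w k f"
  shows "int_homogeneous w (int (wdeg w \<beta>) + (k - int (wdeg w \<alpha>))) (jac_entry f \<beta> \<alpha>)"
proof (cases "mle \<beta> \<alpha>")
  case True
  \<comment> \<open>The summand 0 is the degree of the constant factor 1/(\<alpha> -
    \<beta>)!.\<close>
  have "int_homogeneous w (0 + (k - int (wdeg w (\<alpha> - \<beta>)))) (jac_entry f \<beta> \<alpha>)"
    using True assms unfolding jac_entry_def
    by (simp only: if_True)
      (intro int_homogeneous_mult int_homogeneous_single_zero int_homogeneous_mdiff)
  then show ?thesis
    using True by (simp add: wdeg_diff algebra_simps)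
qed (simp add: jac_entry_def)

lemma int_homogeneous_det:
  assumes "\<And>i j. i < dim_row A \<Longrightarrow> j < dim_col A \<Longrightarrow> int_homogeneous w (r i + c j) (A $$ (i, j))"
  shows "int_homogeneous w ((\<Sum>i<dim_row A. r i) + (\<Sum>j<dim_col A. c j)) (det A)"
proof (cases "dim_row A = dim_col A")
  case True
  let ?m = "dim_row A"
  have "int_homogeneous w ((\<Sum>i<?m. r i) + (\<Sum>j<?m. c j))
      (signof p * (\<Prod>i=0..<?m. A $$ (i, p i)))" if p: "p permutes {0..<?m}" for p
  proof -
    have "int_homogeneous w (\<Sum>i=0..<?m. r i + c (p i)) (\<Prod>i=0..<?m. A $$ (i, p i))"
      using assms True permutes_in_image[OF p] by (intro int_homogeneous_prod) auto
    \<comment> \<open>A permutation meets every column exactly once, so the total no longer depends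
      on \<open>p\<close>.\<close>
    also have "(\<Sum>i=0..<?m. r i + c (p i)) = (\<Sum>i<?m. r i) + (\<Sum>j<?m. c j)"
      using sum.permute[OF p, of c] by (simp add: sum.distrib atLeast0LessThan comp_def)
    finally show ?thesis
      by (auto simp: sign_def intro: int_homogeneous_uminus)
  qed
  then show ?thesis
    using True by (auto simp: det_def intro!: int_homogeneous_sum)
\<comment> \<open>The determinant of a non-square matrix is 0 by convention.\<close>
qed (simp add: det_def)

lemma int_homogeneous_maximal_minor:
  assumes "\<And>i j. i < dim_row A \<Longrightarrow> j < dim_col A \<Longrightarrow> int_homogeneous w (r i + c j) (A $$ (i, j))"
    and "g \<in> maximal_minors A"
  shows "\<exists>k. int_homogeneous w k g"
proof -
  obtain J where J: "J \<subseteq> {..<dim_col A}" and g: "g = det (submatrix A {..<dim_row A} J)"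
    using assms(2) by (auto simp: maximal_minors_def)
  let ?I = "{..<dim_row A}"
  let ?S = "submatrix A ?I J"
  \<comment> \<open>\<open>pick\<close> sends a position in the submatrix to its index in
    \<open>A\<close>, so the splitting of degrees is inherited by reindexing.\<close>
  have "int_homogeneous w (r (pick ?I i) + c (pick J j)) (?S $$ (i, j))"
    if "i < dim_row ?S" "j < dim_col ?S" for i j
  proof -
    have *: "i < card {i. i < dim_row A \<and> i \<in> ?I}" "j < card {j. j < dim_col A \<and> j \<in> J}"
      using that by (simp_all add: dim_submatrix)
    show ?thesis
      unfolding submatrix_index[OF *] using * by (intro assms(1) pick_le)
  qed
  from int_homogeneous_det[OF this] show ?thesis
    unfolding g by blast
qed

theorem theorem1:
  fixes w :: "'s::{finite,linorder} \<Rightarrow> nat"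
    and f :: "('s \<Rightarrow>\<^sub>0 nat) \<Rightarrow>\<^sub>0 complex"
    and d n :: nat
  assumes "weighted_homogeneous w d f"
    and "n \<ge> 1"
  shows "weighted_homogeneous_ideal w (jacobian_ideal n f)"
proof -
  \<comment> \<open>The degree \<open>d\<close> of \<open>f\<close> is charged to the columns; the
    column part is negative where the weight of \<alpha> exceeds \<open>d\<close>.\<close>
  let ?row = "\<lambda>i. int (wdeg w (jac_rows n ! i))"
    and ?col = "\<lambda>j. int d - int (wdeg w (jac_cols n ! j))"
  have "int_homogeneous w (?row i + ?col j) (Jac n f $$ (i, j))"
    if "i < dim_row (Jac n f)" "j < dim_col (Jac n f)" for i j
    using that assms(1) by (simp add: Jac_def int_homogeneous_jac_entry int_homogeneous_of_nat)
  then have "\<exists>k. weighted_homogeneous w k g" if "g \<in> maximal_minors (Jac n f)" for g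
    using int_homogeneous_maximal_minor[OF _ that, of w ?row ?col]
    by (blast intro: int_homogeneous_imp_weighted_homogeneous)
  then show ?thesis
    unfolding weighted_homogeneous_ideal_def jacobian_ideal_def by blast
qed

end
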